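(* For $i=1,2$ let $P_i\subset\mathbb{R}^2$ be the pentagon with vertices $$v_{i0}=(0,f_i^L),\quad v_{i1}=(p_{i1},f_i^L),\quad v_{i2}=(p_{i2},b_i),\quad v_{i3}=(1,f_i^U),\quad v_{i4}=(0,f_i^U),$$ where $0\le p_{i1}<p_{i2}\le 1$ and $f_i^L<b_i<f_i^U$. Let $P=P_1\times P_2=\{(x_1,x_2,t_1,t_2): (x_1,t_1)\in P_1,\ (x_2,t_2)\in P_2\}$. Define $$r_{i1}:=\frac{p_{i2}-p_{i1}}{b_i-f_i^L},\qquad r_{i2}:=\frac{1-p_{i2}}{f_i^U-b_i},\qquad w_i:=\frac{1}{r_{i1}-r_{i2}}.$$ (1) The convex envelope over $P$ of the function $(x,t)\mapsto t_1t_2$ is $$\max_{j=1,\ldots,6}\bigl\{\langle\alpha_j,(x,t)\rangle+c_j\bigr\},$$ where $(x,t)=(x_1,x_2,t_1,t_2)$, $\alpha_j$ is the $j$-th row of $$\begin{bmatrix} 0&0&f_2^U&f_1^U\\ 0&0&f_2^L&f_1^L\\ (f_2^U-f_2^L)w_1&0&f_2^L-r_{12}(f_2^U-f_2^L)w_1&b_1\\ 0&(f_1^U-f_1^L)w_2&b_2&f_1^L-r_{22}(f_1^U-f_1^L)w_2\\ (f_2^U-b_2)w_1&(f_1^U-b_1)w_2&b_2-r_{12}(f_2^U-b_2)w_1&b_1-r_{22}(f_1^U-b_1)w_2\\ (b_2-f_2^L)w_1&(b_1-f_1^L)w_2&b_2-r_{11}(b_2-f_2^L)w_1&b_1-r_{21}(b_1-f_1^L)w_2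 \end{bmatrix}$$ and $c_j=f_1^Uf_2^L-\bigl(\alpha_{j1}+\alpha_{j2}p_{21}+\alpha_{j3}f_1^U+\alpha_{j4}f_2^L\bigr)$. (2) The concave envelope over $P$ of the function $(x,t)\mapsto t_1t_2$ is $$\min_{k=1,\ldots,6}\bigl\{\langle\beta_k,(x,t)\rangle+d_k\bigr\},$$ where $\beta_k$ is the $k$-th row of $$\begin{bmatrix} 0&0&f_2^U&f_1^L\\ 0&0&f_2^L&f_1^U\\ (f_2^L-f_2^U)w_1&0&f_2^L-r_{11}(f_2^L-f_2^U)w_1&b_1\\ 0&(f_1^L-f_1^U)w_2&b_2&f_1^L-r_{21}(f_1^L-f_1^U)w_2\\ (f_2^L-b_2)w_1&(b_1-f_1^U)w_2&b_2-r_{12}(f_2^L-b_2)w_1&b_1-r_{21}(b_1-f_1^U)w_2\\ (b_2-f_2^U)w_1&(f_1^L-b_1)w_2&b_2-r_{11}(b_2-f_2^U)w_1&b_1-r_{22}(f_1^L-b_1)w_2 \end{bmatrix}$$ and $d_k=f_1^Uf_2^U-\bigl(\beta_{k1}+\beta_{k2}+\beta_{k3}f_1^U+\beta_{k4}f_2^U\bigr)$.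
   Context: The convex (respectively concave) envelope of a function over a convex set $P$ is the largest convex underestimator (respectively smallest concave overestimator) of the function on $P$. The pentagon $P_i$ is a convex polygon, $P_i=\operatorname{conv}\{v_{i0},v_{i1},v_{i2},v_{i3},v_{i4}\}$, and the listed points are its vertices (with $v_{i0}=v_{i1}$ allowed when $p_{i1}=0$). In particular $v_{i2}$ is a genuine vertex of $P_i$, which is equivalent to $r_{i1}>r_{i2}$, so that $w_i$ is well defined and positive. *)

theory Defs
  imports "HOL-Analysis.Analysis"
begin

definition is_convex_envelope ::
    "'a::real_vector set \<Rightarrow> ('a \<Rightarrow> real) \<Rightarrow> ('a \<Rightarrow> real) \<Rightarrow> bool" where
  "is_convex_envelope S f g \<longleftrightarrow>
     convex_on S g \<and> (\<forall>z\<in>S. g z \<le> f z) \<and>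
     (\<forall>h. convex_on S h \<and> (\<forall>z\<in>S. h z \<le> f z) \<longrightarrow> (\<forall>z\<in>S. h z \<le> g z))"

definition is_concave_envelope ::
    "'a::real_vector set \<Rightarrow> ('a \<Rightarrow> real) \<Rightarrow> ('a \<Rightarrow> real) \<Rightarrow> bool" where
  "is_concave_envelope S f g \<longleftrightarrow>
     concave_on S g \<and> (\<forall>z\<in>S. f z \<le> g z) \<and>
     (\<forall>h. concave_on S h \<and> (\<forall>z\<in>S. f z \<le> h z) \<longrightarrow> (\<forall>z\<in>S. g z \<le> h z))"

text \<open>
  The data are \<open>p i j\<close>, \<open>fL i\<close>, \<open>b i\<close>, \<open>fU i\<close>, used only for \<open>i, j\<close> in \<open>{1, 2}\<close>.
  A point of the \<open>i\<close>-th plane is the pair \<open>(x\<^sub>i, t\<^sub>i)\<close>; a point of the product is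
  reordered as \<open>(x\<^sub>1, x\<^sub>2, t\<^sub>1, t\<^sub>2)\<close>.
\<close>

definition pent_vertex ::
    "(nat \<Rightarrow> nat \<Rightarrow> real) \<Rightarrow> (nat \<Rightarrow> real) \<Rightarrow> (nat \<Rightarrow> real) \<Rightarrow> (nat \<Rightarrow> real) \<Rightarrow>
     nat \<Rightarrow> nat \<Rightarrow> real \<times> real" where
  "pent_vertex p fL b fU i j =
     [(0, fL i), (p i 1, fL i), (p i 2, b i), (1, fU i), (0, fU i)] ! j"

definition pentagon ::
    "(nat \<Rightarrow> nat \<Rightarrow> real) \<Rightarrow> (nat \<Rightarrow> real) \<Rightarrow> (nat \<Rightarrow> real) \<Rightarrow> (nat \<Rightarrow> real) \<Rightarrow>
     nat \<Rightarrow> (real \<times> real) set" where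
  "pentagon p fL b fU i = convex hull (pent_vertex p fL b fU i ` {0..4})"

definition pentagon_product ::
    "(nat \<Rightarrow> nat \<Rightarrow> real) \<Rightarrow> (nat \<Rightarrow> real) \<Rightarrow> (nat \<Rightarrow> real) \<Rightarrow> (nat \<Rightarrow> real) \<Rightarrow>
     (real \<times> real \<times> real \<times> real) set" where
  "pentagon_product p fL b fU =
     {(x1, x2, t1, t2). (x1, t1) \<in> pentagon p fL b fU 1 \<and> (x2, t2) \<in> pentagon p fL b fU 2}"

definition pent_r1 ::
    "(nat \<Rightarrow> nat \<Rightarrow> real) \<Rightarrow> (nat \<Rightarrow> real) \<Rightarrow> (nat \<Rightarrow> real) \<Rightarrow> (nat \<Rightarrow> real) \<Rightarrow> nat \<Rightarrow> real" where
  "pent_r1 p fL b fU i = (p i 2 - p i 1) / (b i - fL i)"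

definition pent_r2 ::
    "(nat \<Rightarrow> nat \<Rightarrow> real) \<Rightarrow> (nat \<Rightarrow> real) \<Rightarrow> (nat \<Rightarrow> real) \<Rightarrow> (nat \<Rightarrow> real) \<Rightarrow> nat \<Rightarrow> real" where
  "pent_r2 p fL b fU i = (1 - p i 2) / (fU i - b i)"

definition pent_w ::
    "(nat \<Rightarrow> nat \<Rightarrow> real) \<Rightarrow> (nat \<Rightarrow> real) \<Rightarrow> (nat \<Rightarrow> real) \<Rightarrow> (nat \<Rightarrow> real) \<Rightarrow> nat \<Rightarrow> real" where
  "pent_w p fL b fU i = 1 / (pent_r1 p fL b fU i - pent_r2 p fL b fU i)"

definition alpha_row ::
    "(nat \<Rightarrow> nat \<Rightarrow> real) \<Rightarrow> (nat \<Rightarrow> real) \<Rightarrow> (nat \<Rightarrow> real) \<Rightarrow> (nat \<Rightarrow> real) \<Rightarrow>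
     nat \<Rightarrow> real \<times> real \<times> real \<times> real" where
  "alpha_row p fL b fU j =
    (let r11 = pent_r1 p fL b fU 1; r12 = pent_r2 p fL b fU 1; w1 = pent_w p fL b fU 1;
         r21 = pent_r1 p fL b fU 2; r22 = pent_r2 p fL b fU 2; w2 = pent_w p fL b fU 2
     in [(0, 0, fU 2, fU 1),
         (0, 0, fL 2, fL 1),
         ((fU 2 - fL 2) * w1, 0, fL 2 - r12 * (fU 2 - fL 2) * w1, b 1),
         (0, (fU 1 - fL 1) * w2, b 2, fL 1 - r22 * (fU 1 - fL 1) * w2),
         ((fU 2 - b 2) * w1, (fU 1 - b 1) * w2,
            b 2 - r12 * (fU 2 - b 2) * w1, b 1 - r22 * (fU 1 - b 1) * w2),
         ((b 2 - fL 2) * w1, (b 1 - fL 1) * w2,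
            b 2 - r11 * (b 2 - fL 2) * w1, b 1 - r21 * (b 1 - fL 1) * w2)] ! (j - 1))"

text \<open>
  The constants make every affine piece equal to \<open>t\<^sub>1 t\<^sub>2\<close> at one vertex of the product:
  \<open>(1, p 2 1, fU 1, fL 2)\<close> for the convex and \<open>(1, 1, fU 1, fU 2)\<close> for the concave envelope.
\<close>

definition alpha_const ::
    "(nat \<Rightarrow> nat \<Rightarrow> real) \<Rightarrow> (nat \<Rightarrow> real) \<Rightarrow> (nat \<Rightarrow> real) \<Rightarrow> (nat \<Rightarrow> real) \<Rightarrow> nat \<Rightarrow> real" where
  "alpha_const p fL b fU j =
    (case alpha_row p fL b fU j of (a1, a2, a3, a4) \<Rightarrow>
       fU 1 * fL 2 - (a1 + a2 * p 2 1 + a3 * fU 1 + a4 * fL 2))"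

definition beta_row ::
    "(nat \<Rightarrow> nat \<Rightarrow> real) \<Rightarrow> (nat \<Rightarrow> real) \<Rightarrow> (nat \<Rightarrow> real) \<Rightarrow> (nat \<Rightarrow> real) \<Rightarrow>
     nat \<Rightarrow> real \<times> real \<times> real \<times> real" where
  "beta_row p fL b fU k =
    (let r11 = pent_r1 p fL b fU 1; r12 = pent_r2 p fL b fU 1; w1 = pent_w p fL b fU 1;
         r21 = pent_r1 p fL b fU 2; r22 = pent_r2 p fL b fU 2; w2 = pent_w p fL b fU 2
     in [(0, 0, fU 2, fL 1),
         (0, 0, fL 2, fU 1),
         ((fL 2 - fU 2) * w1, 0, fL 2 - r11 * (fL 2 - fU 2) * w1, b 1),
         (0, (fL 1 - fU 1) * w2, b 2, fL 1 - r21 * (fL 1 - fU 1) * w2),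
         ((fL 2 - b 2) * w1, (b 1 - fU 1) * w2,
            b 2 - r12 * (fL 2 - b 2) * w1, b 1 - r21 * (b 1 - fU 1) * w2),
         ((b 2 - fU 2) * w1, (fL 1 - b 1) * w2,
            b 2 - r11 * (b 2 - fU 2) * w1, b 1 - r22 * (fL 1 - b 1) * w2)] ! (k - 1))"

definition beta_const ::
    "(nat \<Rightarrow> nat \<Rightarrow> real) \<Rightarrow> (nat \<Rightarrow> real) \<Rightarrow> (nat \<Rightarrow> real) \<Rightarrow> (nat \<Rightarrow> real) \<Rightarrow> nat \<Rightarrow> real" where
  "beta_const p fL b fU k =
    (case beta_row p fL b fU k of (b1, b2, b3, b4) \<Rightarrow>
       fU 1 * fU 2 - (b1 + b2 + b3 * fU 1 + b4 * fU 2))"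

end

theory Submission
  imports Defs
begin

text \<open>
  Shift to \<open>T\<^sub>i = t\<^sub>i - b\<^sub>i\<close>, which changes \<open>t\<^sub>1 t\<^sub>2\<close> by an affine function only, and put
  \<open>a\<^sub>i = b\<^sub>i - f\<^sub>i\<^sup>L\<close> and \<open>d\<^sub>i = f\<^sub>i\<^sup>U - b\<^sub>i\<close>.  The two slanted edges of the \<open>i\<close>-th pentagon
  meet at \<open>v\<^sub>i\<^sub>2\<close>.  Let \<open>A\<^sub>i\<close> and \<open>B\<^sub>i\<close> be their slacks, the upper and the lower one, scaled by
  \<open>w\<^sub>i\<close>.  Then \<open>A\<^sub>i, B\<^sub>i \<ge> 0\<close> and \<open>T\<^sub>i = B\<^sub>i - A\<^sub>i\<close> with \<open>- a\<^sub>i \<le> T\<^sub>i \<le> d\<^sub>i\<close> on the pentagon, and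
  up to the affine shift the six functions of the convex envelope are
    \<open>d\<^sub>2 T\<^sub>1 + d\<^sub>1 T\<^sub>2 - d\<^sub>1 d\<^sub>2\<close>,  \<open>- a\<^sub>2 T\<^sub>1 - a\<^sub>1 T\<^sub>2 - a\<^sub>1 a\<^sub>2\<close>,
    \<open>- d\<^sub>2 A\<^sub>1 - a\<^sub>2 B\<^sub>1\<close>,  \<open>- d\<^sub>1 A\<^sub>2 - a\<^sub>1 B\<^sub>2\<close>,  \<open>- d\<^sub>2 A\<^sub>1 - d\<^sub>1 A\<^sub>2\<close>,  \<open>- a\<^sub>2 B\<^sub>1 - a\<^sub>1 B\<^sub>2\<close>
  (\<open>alpha_rows_eq_pieces\<close>).  All of them are at most \<open>T\<^sub>1 T\<^sub>2\<close>
  (\<open>envelope_pieces_le_product\<close>).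

  For the converse, every point of a pentagon is a mean of points at the three heights
  \<open>T\<^sub>i = - a\<^sub>i, 0, d\<^sub>i\<close>, with weights \<open>l\<^sub>i, m\<^sub>i, u\<^sub>i\<close>, such that either \<open>m\<^sub>i = 0\<close> (the point lies
  in the trapezoid \<open>v\<^sub>i\<^sub>0 v\<^sub>i\<^sub>1 v\<^sub>i\<^sub>3 v\<^sub>i\<^sub>4\<close>) or \<open>a\<^sub>i l\<^sub>i = A\<^sub>i\<close> and \<open>d\<^sub>i u\<^sub>i = B\<^sub>i\<close> (it lies in the triangle
  \<open>v\<^sub>i\<^sub>1 v\<^sub>i\<^sub>2 v\<^sub>i\<^sub>3\<close>); see \<open>kinked_pentagon\<close>.  Couple the two three-point distributions
  antimonotonically.  The expectation of \<open>T\<^sub>1 T\<^sub>2\<close> under this coupling is one of the six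
  expressions above, with \<open>a\<^sub>i l\<^sub>i\<close> and \<open>d\<^sub>i u\<^sub>i\<close> in place of \<open>A\<^sub>i\<close> and \<open>B\<^sub>i\<close>, and the last
  four only occur when the weights \<open>m\<^sub>i\<close> of the coordinates that they involve are nonzero
  (\<open>antimonotone_coupling\<close>).  Hence it is the value of one of the six functions at the given
  point, and by Jensen's inequality this value bounds every convex minorant
  (\<open>convex_minorant_le_envelope_piece\<close>).

  For the concave envelope, replace \<open>T\<^sub>2\<close> by \<open>- T\<^sub>2\<close>: this exchanges \<open>A\<^sub>2\<close> with \<open>B\<^sub>2\<close> and \<open>a\<^sub>2\<close>
  with \<open>d\<^sub>2\<close>, and the structure used above is invariant under this exchange (\<open>kinked_swap\<close>).
\<close>

section \<open>Envelopes that are finite maxima or minima\<close>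

lemma convex_on_affine:
  fixes k :: "'a::real_inner"
  assumes "convex S"
  shows "convex_on S (\<lambda>z. k \<bullet> z + c)"
  unfolding convex_on_def
proof (intro conjI ballI allI impI)
  fix x y and u v :: real
  assume uv: "u + v = 1"
  have "k \<bullet> (u *\<^sub>R x + v *\<^sub>R y) + c = u * (k \<bullet> x) + v * (k \<bullet> y) + (u + v) * c"
    using uv by (simp add: inner_add_right)
  then show "k \<bullet> (u *\<^sub>R x + v *\<^sub>R y) + c \<le> u * (k \<bullet> x + c) + v * (k \<bullet> y + c)"
    by (simp add: algebra_simps)
qed (fact assms)

lemma convex_on_MAX:
  fixes F :: "'i \<Rightarrow> 'a::real_vector \<Rightarrow> real"
  assumes "finite I" "I \<noteq> {}" "convex S" "\<And>j. j \<in> I \<Longrightarrow> convex_on S (F j)"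
  shows "convex_on S (\<lambda>z. MAX j\<in>I. F j z)"
proof (rule convex_onI)
  fix t :: real and x y assume t: "0 < t" "t < 1" and x: "x \<in> S" and y: "y \<in> S"
  let ?M = "\<lambda>z. MAX j\<in>I. F j z"
  have "F j ((1 - t) *\<^sub>R x + t *\<^sub>R y) \<le> (1 - t) * ?M x + t * ?M y" if "j \<in> I" for j
  proof -
    have "F j ((1 - t) *\<^sub>R x + t *\<^sub>R y) \<le> (1 - t) * F j x + t * F j y"
      using assms(4)[OF that] t x y by (simp add: convex_on_def)
    also have "\<dots> \<le> (1 - t) * ?M x + t * ?M y"
      using t that assms(1) by (intro add_mono mult_left_mono Max_ge) auto
    finally show ?thesis .
  qed
  then show "?M ((1 - t) *\<^sub>R x + t *\<^sub>R y) \<le> (1 - t) * ?M x + t * ?M y"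
    using assms(1,2) by (intro Max.boundedI) auto
qed (fact assms(3))

lemma is_convex_envelope_MAX:
  fixes F :: "'i \<Rightarrow> 'a::real_vector \<Rightarrow> real"
  assumes "finite I" "I \<noteq> {}" "convex S" "\<And>j. j \<in> I \<Longrightarrow> convex_on S (F j)"
    and "\<And>j z. j \<in> I \<Longrightarrow> z \<in> S \<Longrightarrow> F j z \<le> f z"
    and "\<And>h z. convex_on S h \<Longrightarrow> \<forall>z\<in>S. h z \<le> f z \<Longrightarrow> z \<in> S \<Longrightarrow> \<exists>j\<in>I. h z \<le> F j z"
  shows "is_convex_envelope S f (\<lambda>z. MAX j\<in>I. F j z)"
  unfolding is_convex_envelope_def
proof (intro conjI allI impI ballI)
  show "convex_on S (\<lambda>z. MAX j\<in>I. F j z)"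
    using assms(1-4) by (rule convex_on_MAX)
  show "(MAX j\<in>I. F j z) \<le> f z" if "z \<in> S" for z
    using assms(1,2,5) that by (intro Max.boundedI) auto
  show "h z \<le> (MAX j\<in>I. F j z)"
    if h: "convex_on S h \<and> (\<forall>z\<in>S. h z \<le> f z)" and z: "z \<in> S" for h z
  proof -
    obtain j where "j \<in> I" "h z \<le> F j z"
      using assms(6) h z by blast
    then show ?thesis
      using assms(1) by (auto intro: order_trans Max_ge)
  qed
qed

lemma is_concave_envelope_iff:
  "is_concave_envelope S f g \<longleftrightarrow> is_convex_envelope S (\<lambda>z. - f z) (\<lambda>z. - g z)"
proof -
  have "(\<forall>h. concave_on S h \<and> (\<forall>z\<in>S. f z \<le> h z) \<longrightarrow> (\<forall>z\<in>S. g z \<le> h z)) \<longleftrightarrow>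
        (\<forall>h. convex_on S h \<and> (\<forall>z\<in>S. h z \<le> - f z) \<longrightarrow> (\<forall>z\<in>S. h z \<le> - g z))"
    (is "?L \<longleftrightarrow> ?R")
  proof
    assume L: ?L
    show ?R
    proof (intro allI impI)
      fix h assume "convex_on S h \<and> (\<forall>z\<in>S. h z \<le> - f z)"
      then show "\<forall>z\<in>S. h z \<le> - g z"
        using L[rule_format, of "\<lambda>z. - h z"] by (force simp: concave_on_def)
    qed
  next
    assume R: ?R
    show ?L
    proof (intro allI impI)
      fix h assume "concave_on S h \<and> (\<forall>z\<in>S. f z \<le> h z)"
      then show "\<forall>z\<in>S. g z \<le> h z"
        using R[rule_format, of "\<lambda>z. - h z"] by (force simp: concave_on_def)
    qed
  qed
  then show ?thesis
    by (simp add: is_concave_envelope_def is_convex_envelope_def concave_on_def)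
qed

lemma is_concave_envelope_MIN:
  assumes "finite I" "I \<noteq> {}"
    and "is_convex_envelope S (\<lambda>z. - f z) (\<lambda>z. MAX j\<in>I. - F j z)"
  shows "is_concave_envelope S f (\<lambda>z. MIN j\<in>I. F j z)"
proof -
  have "- (MIN j\<in>I. F j z) = (MAX j\<in>I. - F j z)" for z
    using assms(1,2) by (simp add: minus_Min_eq_Max image_image)
  then show ?thesis
    using assms(3) by (simp add: is_concave_envelope_iff)
qed

section \<open>Couplings of three-point distributions\<close>

lemma convex_on_coupling:
  fixes h :: "'a::real_vector \<times> 'b::real_vector \<Rightarrow> real"
    and \<gamma> :: "'i \<Rightarrow> 'j \<Rightarrow> real"
  assumes h: "convex_on (A \<times> B) h" and fin: "finite I" "finite J"
    and nonneg: "\<And>i j. i \<in> I \<Longrightarrow> j \<in> J \<Longrightarrow> 0 \<le> \<gamma> i j"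
    and rows: "\<And>i. i \<in> I \<Longrightarrow> (\<Sum>j\<in>J. \<gamma> i j) = \<mu> i"
    and cols: "\<And>j. j \<in> J \<Longrightarrow> (\<Sum>i\<in>I. \<gamma> i j) = \<nu> j"
    and total: "(\<Sum>i\<in>I. \<mu> i) = 1"
    and x: "\<And>i. i \<in> I \<Longrightarrow> x i \<in> A" and y: "\<And>j. j \<in> J \<Longrightarrow> y j \<in> B"
  shows "h (\<Sum>i\<in>I. \<mu> i *\<^sub>R x i, \<Sum>j\<in>J. \<nu> j *\<^sub>R y j) \<le> (\<Sum>i\<in>I. \<Sum>j\<in>J. \<gamma> i j * h (x i, y j))"
proof -
  have tot: "(\<Sum>k\<in>I \<times> J. \<gamma> (fst k) (snd k)) = 1"
    using rows total by (simp add: sum.cartesian_product')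
  then have "I \<times> J \<noteq> {}" by fastforce
  then have "h (\<Sum>k\<in>I \<times> J. \<gamma> (fst k) (snd k) *\<^sub>R (x (fst k), y (snd k)))
      \<le> (\<Sum>k\<in>I \<times> J. \<gamma> (fst k) (snd k) * h (x (fst k), y (snd k)))"
    using fin nonneg x y by (intro convex_on_sum[OF _ _ h tot]) auto
  moreover have "(\<Sum>k\<in>I \<times> J. \<gamma> (fst k) (snd k) *\<^sub>R (x (fst k), y (snd k)))
      = (\<Sum>i\<in>I. \<mu> i *\<^sub>R x i, \<Sum>j\<in>J. \<nu> j *\<^sub>R y j)"
  proof (rule prod_eqI)
    show "fst (\<Sum>k\<in>I \<times> J. \<gamma> (fst k) (snd k) *\<^sub>R (x (fst k), y (snd k)))
      = fst (\<Sum>i\<in>I. \<mu> i *\<^sub>R x i, \<Sum>j\<in>J. \<nu> j *\<^sub>R y j)"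
      using rows by (simp add: fst_sum sum.cartesian_product' flip: scaleR_left.sum)
    have "(\<Sum>i\<in>I. \<Sum>j\<in>J. \<gamma> i j *\<^sub>R y j) = (\<Sum>j\<in>J. \<nu> j *\<^sub>R y j)"
      using cols by (subst sum.swap) (simp flip: scaleR_left.sum)
    then show "snd (\<Sum>k\<in>I \<times> J. \<gamma> (fst k) (snd k) *\<^sub>R (x (fst k), y (snd k)))
      = snd (\<Sum>i\<in>I. \<mu> i *\<^sub>R x i, \<Sum>j\<in>J. \<nu> j *\<^sub>R y j)"
      by (simp add: snd_sum sum.cartesian_product')
  qed
  ultimately show ?thesis
    by (simp add: sum.cartesian_product')
qed

lemma sum_lessThan_3: "(\<Sum>i<3. f i) = f 0 + f 1 + f (2::nat)"
  by (simp add: eval_nat_numeral)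

lemma all_less_3: "(\<forall>i<3::nat. P i) \<longleftrightarrow> P 0 \<and> P 1 \<and> P 2"
  by (auto simp: eval_nat_numeral less_Suc_eq)

text \<open>
  The coupling matches the small values of the first distribution with the large values of
  the second.  Rows of a coupling belong to the values \<open>- a1, 0, d1\<close> and columns to
  \<open>- a2, 0, d2\<close>.  The conditions on \<open>m1\<close> and \<open>m2\<close> in the last four cases hold because, if
  \<open>m1 = 0\<close> and neither \<open>u1 + u2\<close> nor \<open>l1 + l2\<close> reaches 1, then \<open>u2 < l1\<close> and \<open>l2 < u1\<close>, which
  leaves only the fourth case; likewise \<open>m2 = 0\<close> leaves only the third.
\<close>

lemma antimonotone_coupling:
  fixes a1 d1 a2 d2 l1 m1 u1 l2 m2 u2 :: real
  assumes 1: "0 \<le> l1" "0 \<le> m1" "0 \<le> u1" "l1 + m1 + u1 = 1"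
    and 2: "0 \<le> l2" "0 \<le> m2" "0 \<le> u2" "l2 + m2 + u2 = 1"
  obtains \<gamma> :: "nat \<Rightarrow> nat \<Rightarrow> real" and c where
    "\<forall>i<3. \<forall>j<3. 0 \<le> \<gamma> i j"
    "\<forall>i<3. (\<Sum>j<3. \<gamma> i j) = [l1, m1, u1] ! i"
    "\<forall>j<3. (\<Sum>i<3. \<gamma> i j) = [l2, m2, u2] ! j"
    "(\<Sum>i<3. \<Sum>j<3. \<gamma> i j * ([- a1, 0, d1] ! i * [- a2, 0, d2] ! j)) = c"
    "c = d2 * (d1 * u1 - a1 * l1) + d1 * (d2 * u2 - a2 * l2) - d1 * d2 \<or>
     c = - a2 * (d1 * u1 - a1 * l1) - a1 * (d2 * u2 - a2 * l2) - a1 * a2 \<or>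
     m1 \<noteq> 0 \<and> c = - d2 * (a1 * l1) - a2 * (d1 * u1) \<or>
     m2 \<noteq> 0 \<and> c = - d1 * (a2 * l2) - a1 * (d2 * u2) \<or>
     m1 \<noteq> 0 \<and> m2 \<noteq> 0 \<and> c = - d2 * (a1 * l1) - d1 * (a2 * l2) \<or>
     m1 \<noteq> 0 \<and> m2 \<noteq> 0 \<and> c = - a2 * (d1 * u1) - a1 * (d2 * u2)"
proof -
  \<comment> \<open>the coupling with a given matrix\<close>
  define G :: "real list list \<Rightarrow> nat \<Rightarrow> nat \<Rightarrow> real" where "G = (\<lambda>M i j. M ! i ! j)"
  note S = G_def sum_lessThan_3 all_less_3 numeral_2_eq_2
  consider "1 \<le> u1 + u2" | "1 \<le> l1 + l2"
    | "u1 + u2 < 1" "l1 + l2 < 1" "l1 \<le> u2" "u1 \<le> l2"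
    | "u1 + u2 < 1" "l1 + l2 < 1" "u2 \<le> l1" "l2 \<le> u1"
    | "u1 + u2 < 1" "l1 + l2 < 1" "l1 \<le> u2" "l2 \<le> u1"
    | "u1 + u2 < 1" "l1 + l2 < 1" "u2 \<le> l1" "u1 \<le> l2"
    by linarith
  then show thesis
  proof cases
    case 1
    show ?thesis
      by (rule that[of "G [[0, 0, l1], [0, 0, m1], [l2, m2, u1 + u2 - 1]]"
            "d2 * (d1 * u1 - a1 * l1) + d1 * (d2 * u2 - a2 * l2) - d1 * d2"];
          simp add: S algebra_simps;
          insert assms 1, (intro conjI)?; linarith)
  next
    case 2
    show ?thesis
      by (rule that[of "G [[l1 + l2 - 1, m2, u2], [m1, 0, 0], [u1, 0, 0]]"
            "- a2 * (d1 * u1 - a1 * l1) - a1 * (d2 * u2 - a2 * l2) - a1 * a2"];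
          simp add: S algebra_simps;
          insert assms 2, (intro conjI)?; linarith)
  next
    case 3
    then have "m1 \<noteq> 0" using assms by auto
    show ?thesis
      by (rule that[of "G [[0, 0, l1], [l2 - u1, m2, u2 - l1], [u1, 0, 0]]"
            "- d2 * (a1 * l1) - a2 * (d1 * u1)"];
          simp add: S algebra_simps \<open>m1 \<noteq> 0\<close>;
          insert assms 3, (intro conjI)?; linarith)
  next
    case 4
    then have "m2 \<noteq> 0" using assms by auto
    show ?thesis
      by (rule that[of "G [[0, l1 - u2, u2], [0, m1, 0], [l2, u1 - l2, 0]]"
            "- d1 * (a2 * l2) - a1 * (d2 * u2)"];
          simp add: S algebra_simps \<open>m2 \<noteq> 0\<close>;
          insert assms 4, (intro conjI)?; linarith)
  next
    case 5
    then have "m1 \<noteq> 0" "m2 \<noteq> 0" using assms by auto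
    show ?thesis
      by (rule that[of "G [[0, 0, l1], [0, 1 - u1 - u2, u2 - l1], [l2, u1 - l2, 0]]"
            "- d2 * (a1 * l1) - d1 * (a2 * l2)"];
          simp add: S algebra_simps \<open>m1 \<noteq> 0\<close> \<open>m2 \<noteq> 0\<close>;
          insert assms 5, (intro conjI)?; linarith)
  next
    case 6
    then have "m1 \<noteq> 0" "m2 \<noteq> 0" using assms by auto
    show ?thesis
      by (rule that[of "G [[0, l1 - u2, u2], [l2 - u1, 1 - l1 - l2, 0], [u1, 0, 0]]"
            "- a2 * (d1 * u1) - a1 * (d2 * u2)"];
          simp add: S algebra_simps \<open>m1 \<noteq> 0\<close> \<open>m2 \<noteq> 0\<close>;
          insert assms 6, (intro conjI)?; linarith)
  qed
qed

section \<open>Products of kinked differences\<close>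

text \<open>
  What the argument uses about the pentagon and its two slacks.  The functions \<open>A\<close> and \<open>B\<close>
  are nonnegative on \<open>Q\<close>, and \<open>T = B - A\<close> takes values in \<open>[- a, d]\<close>.  Every point of \<open>Q\<close> is a
  convex combination, with weights \<open>l, m, u\<close>, of points of \<open>Q\<close> with \<open>T = - a\<close>, \<open>T = 0\<close> and
  \<open>T = d\<close>, so that \<open>a * l\<close> and \<open>d * u\<close> are the means of the negative and the positive part of
  \<open>T\<close>.  Their difference gives \<open>T\<close> at the point; where \<open>m\<close> is nonzero, they are \<open>A\<close> and \<open>B\<close>
  themselves.
\<close>

definition kinked :: "'a::real_vector set \<Rightarrow> ('a \<Rightarrow> real) \<Rightarrow> ('a \<Rightarrow> real) \<Rightarrow> real \<Rightarrow> real \<Rightarrow> bool" where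
  "kinked Q A B a d \<longleftrightarrow>
     (\<forall>z\<in>Q. 0 \<le> A z \<and> 0 \<le> B z \<and> - a \<le> B z - A z \<and> B z - A z \<le> d) \<and>
     (\<forall>z\<in>Q. \<exists>l m u. 0 \<le> l \<and> 0 \<le> m \<and> 0 \<le> u \<and> l + m + u = 1 \<and>
        d * u - a * l = B z - A z \<and> (m \<noteq> 0 \<longrightarrow> a * l = A z \<and> d * u = B z) \<and>
        (\<exists>x\<in>Q. \<exists>y\<in>Q. \<exists>v\<in>Q. B x - A x = - a \<and> B y - A y = 0 \<and> B v - A v = d \<and>
           z = l *\<^sub>R x + m *\<^sub>R y + u *\<^sub>R v))"

lemma kinkedE:
  assumes "kinked Q A B a d" "z \<in> Q"
  obtains l m u x y v where
    "0 \<le> l" "0 \<le> m" "0 \<le> u" "l + m + u = 1" "B z - A z = d * u - a * l"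
    "m \<noteq> 0 \<longrightarrow> A z = a * l \<and> B z = d * u"
    "x \<in> Q" "y \<in> Q" "v \<in> Q" "B x - A x = - a" "B y - A y = 0" "B v - A v = d"
    "z = l *\<^sub>R x + m *\<^sub>R y + u *\<^sub>R v"
proof -
  have "\<exists>l m u. 0 \<le> l \<and> 0 \<le> m \<and> 0 \<le> u \<and> l + m + u = 1 \<and>
        d * u - a * l = B z - A z \<and> (m \<noteq> 0 \<longrightarrow> a * l = A z \<and> d * u = B z) \<and>
        (\<exists>x\<in>Q. \<exists>y\<in>Q. \<exists>v\<in>Q. B x - A x = - a \<and> B y - A y = 0 \<and> B v - A v = d \<and>
           z = l *\<^sub>R x + m *\<^sub>R y + u *\<^sub>R v)"
    using assms unfolding kinked_def by blast
  then show thesis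
    by (elim exE bexE conjE) (rule that; simp)
qed

lemma kinked_bounds:
  assumes "kinked Q A B a d" "z \<in> Q"
  shows "0 \<le> A z" "0 \<le> B z" "- a \<le> B z - A z" "B z - A z \<le> d"
  using assms by (auto simp: kinked_def)

lemma kinked_swap:
  assumes "kinked Q A B a d"
  shows "kinked Q B A d a"
  unfolding kinked_def
proof (intro conjI ballI)
  fix z assume z: "z \<in> Q"
  show "0 \<le> B z" "0 \<le> A z" "- d \<le> A z - B z" "A z - B z \<le> a"
    using kinked_bounds[OF assms z] by simp_all
  obtain l m u x y v where *:
    "0 \<le> l" "0 \<le> m" "0 \<le> u" "l + m + u = 1" "B z - A z = d * u - a * l"
    "m \<noteq> 0 \<longrightarrow> A z = a * l \<and> B z = d * u"
    "x \<in> Q" "y \<in> Q" "v \<in> Q" "B x - A x = - a" "B y - A y = 0" "B v - A v = d"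
    "z = l *\<^sub>R x + m *\<^sub>R y + u *\<^sub>R v"
    by (rule kinkedE[OF assms z])
  show "\<exists>l m u. 0 \<le> l \<and> 0 \<le> m \<and> 0 \<le> u \<and> l + m + u = 1 \<and>
        a * u - d * l = A z - B z \<and> (m \<noteq> 0 \<longrightarrow> d * l = B z \<and> a * u = A z) \<and>
        (\<exists>x\<in>Q. \<exists>y\<in>Q. \<exists>v\<in>Q. A x - B x = - d \<and> A y - B y = 0 \<and> A v - B v = a \<and>
           z = l *\<^sub>R x + m *\<^sub>R y + u *\<^sub>R v)"
  proof (rule exI[of _ u], rule exI[of _ m], rule exI[of _ l], intro conjI)
    have "z = u *\<^sub>R v + m *\<^sub>R y + l *\<^sub>R x"
      using *(13) by (simp add: add_ac)
    moreover have "A v - B v = - d" "A y - B y = 0" "A x - B x = a"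
      using *(10-12) by linarith+
    ultimately show "\<exists>x\<in>Q. \<exists>y\<in>Q. \<exists>v\<in>Q. A x - B x = - d \<and> A y - B y = 0 \<and> A v - B v = a \<and>
           z = u *\<^sub>R x + m *\<^sub>R y + l *\<^sub>R v"
      using *(7-9) by blast
  qed (use *(1-6) in \<open>linarith | blast\<close>)+
qed

text \<open>
  The values of the six affine functions whose maximum is the convex envelope of
  \<open>(B1 - A1) * (B2 - A2)\<close>.  A set rather than a sequence, because the exchange of \<open>A2\<close> and
  \<open>B2\<close> does not preserve the order of the rows.
\<close>

definition envelope_pieces ::
    "real \<Rightarrow> real \<Rightarrow> real \<Rightarrow> real \<Rightarrow> real \<Rightarrow> real \<Rightarrow> real \<Rightarrow> real \<Rightarrow> real set" where
  "envelope_pieces a1 d1 a2 d2 A1 B1 A2 B2 =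
     {d2 * (B1 - A1) + d1 * (B2 - A2) - d1 * d2,
      - a2 * (B1 - A1) - a1 * (B2 - A2) - a1 * a2,
      - d2 * A1 - a2 * B1, - d1 * A2 - a1 * B2,
      - d2 * A1 - d1 * A2, - a2 * B1 - a1 * B2}"

lemma envelope_pieces_le_product:
  fixes a1 d1 a2 d2 A1 B1 A2 B2 :: real
  assumes 1: "0 \<le> A1" "0 \<le> B1" "- a1 \<le> B1 - A1" "B1 - A1 \<le> d1"
    and 2: "0 \<le> A2" "0 \<le> B2" "- a2 \<le> B2 - A2" "B2 - A2 \<le> d2"
    and pos: "0 \<le> a1" "0 \<le> d1" "0 \<le> a2" "0 \<le> d2"
    and c: "c \<in> envelope_pieces a1 d1 a2 d2 A1 B1 A2 B2"
  shows "c \<le> (B1 - A1) * (B2 - A2)"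
proof -
  define T1 T2 where "T1 = B1 - A1" and "T2 = B2 - A2"
  have T: "B1 = T1 + A1" "B2 = T2 + A2" by (simp_all add: T1_def T2_def)
  have bounds: "- a1 \<le> T1" "T1 \<le> d1" "- a2 \<le> T2" "T2 \<le> d2"
    using 1 2 by (simp_all add: T1_def T2_def)
  \<comment> \<open>the slacks dominate the negative and the positive parts of \<open>T1\<close> and \<open>T2\<close>\<close>
  have A: "- T1 \<le> A1" "- T2 \<le> A2" and B: "T1 \<le> B1" "T2 \<le> B2"
    using 1 2 by (simp_all add: T)
  have corner: "0 \<le> (d1 - T1) * (d2 - T2)" "0 \<le> (a1 + T1) * (a2 + T2)"
    using bounds by simp_all
  have one: "0 \<le> A1 * (d2 - T2) + B1 * (a2 + T2)" "0 \<le> A2 * (d1 - T1) + B2 * (a1 + T1)"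
    using bounds 1 2 by simp_all
  \<comment> \<open>a product of factors with opposite signs is at least minus a bound of one factor times
    the slack that dominates the other\<close>
  have two: "- d2 * A1 - d1 * A2 \<le> T1 * T2 \<and> - a2 * B1 - a1 * B2 \<le> T1 * T2"
  proof -
    have nn: "0 \<le> d2 * A1" "0 \<le> d1 * A2" "0 \<le> a2 * B1" "0 \<le> a1 * B2"
      using 1 2 pos by simp_all
    consider "0 \<le> T1 * T2" | "0 \<le> T1" "T2 \<le> 0" | "T1 \<le> 0" "0 \<le> T2"
      by (metis linear mult_nonneg_nonneg mult_nonpos_nonpos)
    then show ?thesis
    proof cases
      case 1 then show ?thesis using nn by linarith
    next
      case 2
      have "T1 * - T2 \<le> d1 * A2" "T1 * - T2 \<le> B1 * a2"
        using 2 A B bounds pos assms by (intro mult_mono; simp)+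
      then show ?thesis using nn by (simp add: mult.commute)
    next
      case 3
      have "- T1 * T2 \<le> A1 * d2" "- T1 * T2 \<le> a1 * B2"
        using 3 A B bounds pos assms by (intro mult_mono; simp)+
      then show ?thesis using nn by (simp add: mult.commute)
    qed
  qed
  show ?thesis
    using c two corner one unfolding envelope_pieces_def
    by (auto simp: T algebra_simps)
qed

lemma convex_minorant_le_envelope_piece:
  fixes h :: "'a::real_vector \<times> 'b::real_vector \<Rightarrow> real"
  assumes Q1: "kinked Q1 A1 B1 a1 d1" and Q2: "kinked Q2 A2 B2 a2 d2"
    and h: "convex_on (Q1 \<times> Q2) h"
    and le: "\<And>z1 z2. z1 \<in> Q1 \<Longrightarrow> z2 \<in> Q2 \<Longrightarrow> h (z1, z2) \<le> (B1 z1 - A1 z1) * (B2 z2 - A2 z2)"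
    and z: "z1 \<in> Q1" "z2 \<in> Q2"
  shows "\<exists>c\<in>envelope_pieces a1 d1 a2 d2 (A1 z1) (B1 z1) (A2 z2) (B2 z2). h (z1, z2) \<le> c"
proof -
  obtain l1 m1 u1 x1 y1 v1 where
    1: "0 \<le> l1" "0 \<le> m1" "0 \<le> u1" "l1 + m1 + u1 = 1"
    and T1: "B1 z1 - A1 z1 = d1 * u1 - a1 * l1"
    and K1: "m1 \<noteq> 0 \<longrightarrow> A1 z1 = a1 * l1 \<and> B1 z1 = d1 * u1"
    and p1: "x1 \<in> Q1" "y1 \<in> Q1" "v1 \<in> Q1"
    and t1: "B1 x1 - A1 x1 = - a1" "B1 y1 - A1 y1 = 0" "B1 v1 - A1 v1 = d1"
    and z1: "z1 = l1 *\<^sub>R x1 + m1 *\<^sub>R y1 + u1 *\<^sub>R v1"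
    by (rule kinkedE[OF Q1 z(1)])
  obtain l2 m2 u2 x2 y2 v2 where
    2: "0 \<le> l2" "0 \<le> m2" "0 \<le> u2" "l2 + m2 + u2 = 1"
    and T2: "B2 z2 - A2 z2 = d2 * u2 - a2 * l2"
    and K2: "m2 \<noteq> 0 \<longrightarrow> A2 z2 = a2 * l2 \<and> B2 z2 = d2 * u2"
    and p2: "x2 \<in> Q2" "y2 \<in> Q2" "v2 \<in> Q2"
    and t2: "B2 x2 - A2 x2 = - a2" "B2 y2 - A2 y2 = 0" "B2 v2 - A2 v2 = d2"
    and z2: "z2 = l2 *\<^sub>R x2 + m2 *\<^sub>R y2 + u2 *\<^sub>R v2"
    by (rule kinkedE[OF Q2 z(2)])
  obtain \<gamma> :: "nat \<Rightarrow> nat \<Rightarrow> real" and c where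
    nonneg: "\<forall>i<3. \<forall>j<3. 0 \<le> \<gamma> i j"
    and rows: "\<forall>i<3. (\<Sum>j<3. \<gamma> i j) = [l1, m1, u1] ! i"
    and cols: "\<forall>j<3. (\<Sum>i<3. \<gamma> i j) = [l2, m2, u2] ! j"
    and cost: "(\<Sum>i<3. \<Sum>j<3. \<gamma> i j * ([- a1, 0, d1] ! i * [- a2, 0, d2] ! j)) = c"
    and c: "c = d2 * (d1 * u1 - a1 * l1) + d1 * (d2 * u2 - a2 * l2) - d1 * d2 \<or>
     c = - a2 * (d1 * u1 - a1 * l1) - a1 * (d2 * u2 - a2 * l2) - a1 * a2 \<or>
     m1 \<noteq> 0 \<and> c = - d2 * (a1 * l1) - a2 * (d1 * u1) \<or>
     m2 \<noteq> 0 \<and> c = - d1 * (a2 * l2) - a1 * (d2 * u2) \<or>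
     m1 \<noteq> 0 \<and> m2 \<noteq> 0 \<and> c = - d2 * (a1 * l1) - d1 * (a2 * l2) \<or>
     m1 \<noteq> 0 \<and> m2 \<noteq> 0 \<and> c = - a2 * (d1 * u1) - a1 * (d2 * u2)"
    by (rule antimonotone_coupling[OF 1 2])
  have in1: "\<forall>i<3. [x1, y1, v1] ! i \<in> Q1"
    and in2: "\<forall>j<3. [x2, y2, v2] ! j \<in> Q2"
    using p1 p2 by (simp_all add: all_less_3)
  have val1: "\<forall>i<3. B1 ([x1, y1, v1] ! i) - A1 ([x1, y1, v1] ! i) = [- a1, 0, d1] ! i"
    and val2: "\<forall>j<3. B2 ([x2, y2, v2] ! j) - A2 ([x2, y2, v2] ! j) = [- a2, 0, d2] ! j"
    using t1 t2 by (simp_all add: all_less_3)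
  have "h (z1, z2) = h (\<Sum>i<3. [l1, m1, u1] ! i *\<^sub>R [x1, y1, v1] ! i,
                        \<Sum>j<3. [l2, m2, u2] ! j *\<^sub>R [x2, y2, v2] ! j)"
    by (simp add: sum_lessThan_3 z1 z2)
  also have "\<dots> \<le> (\<Sum>i<3. \<Sum>j<3. \<gamma> i j * h ([x1, y1, v1] ! i, [x2, y2, v2] ! j))"
    by (rule convex_on_coupling[OF h])
      (use nonneg rows cols in1 in2 1 in \<open>auto simp: sum_lessThan_3\<close>)
  also have "\<dots> \<le> (\<Sum>i<3. \<Sum>j<3. \<gamma> i j * ([- a1, 0, d1] ! i * [- a2, 0, d2] ! j))"
  proof (intro sum_mono mult_left_mono)
    fix i j :: nat assume "i \<in> {..<3}" "j \<in> {..<3}"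
    then have "i < 3" "j < 3" by simp_all
    then show "h ([x1, y1, v1] ! i, [x2, y2, v2] ! j) \<le> [- a1, 0, d1] ! i * [- a2, 0, d2] ! j"
      using le[OF in1[rule_format] in2[rule_format]] val1 val2 by simp
    show "0 \<le> \<gamma> i j" using nonneg \<open>i < 3\<close> \<open>j < 3\<close> by blast
  qed
  finally have "h (z1, z2) \<le> c"
    by (simp add: cost)
  moreover have "c \<in> envelope_pieces a1 d1 a2 d2 (A1 z1) (B1 z1) (A2 z2) (B2 z2)"
    using c unfolding envelope_pieces_def insert_iff
    by (elim disjE conjE) (simp_all add: K1 K2 T1 T2)
  ultimately show ?thesis by blast
qed

text \<open>
  The same bound with the coordinates in the order \<open>(x1, x2, t1, t2)\<close> and with an affine
  function added to the product.
\<close>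

lemma convex_minorant_le_shifted_piece:
  fixes Q1 Q2 :: "(real \<times> real) set" and k :: "real \<times> real \<times> real \<times> real"
  assumes Q1: "kinked Q1 A1 B1 a1 d1" and Q2: "kinked Q2 A2 B2 a2 d2"
    and h: "convex_on {(x1, x2, t1, t2). (x1, t1) \<in> Q1 \<and> (x2, t2) \<in> Q2} h"
    and conv: "convex Q1" "convex Q2"
    and le: "\<And>x1 x2 t1 t2. (x1, t1) \<in> Q1 \<Longrightarrow> (x2, t2) \<in> Q2 \<Longrightarrow>
      h (x1, x2, t1, t2) \<le> (B1 (x1, t1) - A1 (x1, t1)) * (B2 (x2, t2) - A2 (x2, t2))
        + (k \<bullet> (x1, x2, t1, t2) + c0)"
    and z: "(x1, t1) \<in> Q1" "(x2, t2) \<in> Q2"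
  shows "\<exists>c\<in>envelope_pieces a1 d1 a2 d2 (A1 (x1, t1)) (B1 (x1, t1)) (A2 (x2, t2)) (B2 (x2, t2)).
    h (x1, x2, t1, t2) \<le> c + (k \<bullet> (x1, x2, t1, t2) + c0)"
proof -
  define \<phi> :: "(real \<times> real) \<times> (real \<times> real) \<Rightarrow> real \<times> real \<times> real \<times> real"
    where "\<phi> = (\<lambda>((x1, t1), (x2, t2)). (x1, x2, t1, t2))"
  define g where "g = (\<lambda>z. h (\<phi> z) - (k \<bullet> \<phi> z + c0))"
  have \<phi>_in: "\<phi> z \<in> {(x1, x2, t1, t2). (x1, t1) \<in> Q1 \<and> (x2, t2) \<in> Q2}" if "z \<in> Q1 \<times> Q2" for z
    using that by (auto simp: \<phi>_def)
  have \<phi>_lin: "\<phi> (u *\<^sub>R x + v *\<^sub>R y) = u *\<^sub>R \<phi> x + v *\<^sub>R \<phi> y" for u v x y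
    by (simp add: \<phi>_def case_prod_beta)
  have "convex_on (Q1 \<times> Q2) g"
  proof (rule convex_onI)
    show "convex (Q1 \<times> Q2)" using conv by (rule convex_Times)
  next
    fix s :: real and x y
    assume s: "0 < s" "s < 1" and xy: "x \<in> Q1 \<times> Q2" "y \<in> Q1 \<times> Q2"
    have "h (\<phi> ((1 - s) *\<^sub>R x + s *\<^sub>R y)) \<le> (1 - s) * h (\<phi> x) + s * h (\<phi> y)"
      unfolding \<phi>_lin using s by (intro convex_onD[OF h] \<phi>_in xy) auto
    then show "g ((1 - s) *\<^sub>R x + s *\<^sub>R y) \<le> (1 - s) * g x + s * g y"
      unfolding g_def \<phi>_lin inner_add_right inner_scaleR_right by (simp add: algebra_simps)
  qed
  moreover have "g (z1, z2) \<le> (B1 z1 - A1 z1) * (B2 z2 - A2 z2)" if "z1 \<in> Q1" "z2 \<in> Q2" for z1 z2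
    using le[of "fst z1" "snd z1" "fst z2" "snd z2"] that
    by (simp add: g_def \<phi>_def case_prod_beta)
  ultimately have "\<exists>c\<in>envelope_pieces a1 d1 a2 d2 (A1 (x1, t1)) (B1 (x1, t1)) (A2 (x2, t2)) (B2 (x2, t2)).
      g ((x1, t1), (x2, t2)) \<le> c"
    using z by (intro convex_minorant_le_envelope_piece[OF Q1 Q2]) auto
  then show ?thesis
    by (simp add: g_def \<phi>_def algebra_simps)
qed

text \<open>
  The envelope in terms of any finite family of convex functions whose values at each point
  are the shifted pieces, in whatever order.
\<close>

lemma is_convex_envelope_kinked_product:
  fixes Q1 Q2 :: "(real \<times> real) set" and k :: "real \<times> real \<times> real \<times> real"
    and F :: "'i \<Rightarrow> real \<times> real \<times> real \<times> real \<Rightarrow> real"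
  assumes Q1: "kinked Q1 A1 B1 a1 d1" and Q2: "kinked Q2 A2 B2 a2 d2"
    and conv: "convex Q1" "convex Q2"
    and pos: "0 \<le> a1" "0 \<le> d1" "0 \<le> a2" "0 \<le> d2"
    and S: "S = {(x1, x2, t1, t2). (x1, t1) \<in> Q1 \<and> (x2, t2) \<in> Q2}"
    and f: "\<And>x1 x2 t1 t2. f (x1, x2, t1, t2) =
      (B1 (x1, t1) - A1 (x1, t1)) * (B2 (x2, t2) - A2 (x2, t2)) + (k \<bullet> (x1, x2, t1, t2) + c0)"
    and I: "finite I" "I \<noteq> {}" and F_convex: "\<And>j. j \<in> I \<Longrightarrow> convex_on S (F j)"
    and F: "\<And>x1 x2 t1 t2. (\<lambda>j. F j (x1, x2, t1, t2)) ` I =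
      (\<lambda>c. c + (k \<bullet> (x1, x2, t1, t2) + c0)) `
        envelope_pieces a1 d1 a2 d2 (A1 (x1, t1)) (B1 (x1, t1)) (A2 (x2, t2)) (B2 (x2, t2))"
  shows "is_convex_envelope S f (\<lambda>z. MAX j\<in>I. F j z)"
proof (rule is_convex_envelope_MAX[OF I _ F_convex])
  show "convex S" using I F_convex by (blast dest: convex_on_imp_convex)
next
  fix j z assume j: "j \<in> I" and "z \<in> S"
  then obtain x1 x2 t1 t2 where z: "z = (x1, x2, t1, t2)" "(x1, t1) \<in> Q1" "(x2, t2) \<in> Q2"
    by (auto simp: S)
  have "F j z \<in> (\<lambda>j. F j (x1, x2, t1, t2)) ` I"
    using j z(1) by blast
  then obtain c
    where c: "c \<in> envelope_pieces a1 d1 a2 d2 (A1 (x1, t1)) (B1 (x1, t1)) (A2 (x2, t2)) (B2 (x2, t2))"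
      and Fj: "F j z = c + (k \<bullet> (x1, x2, t1, t2) + c0)"
    unfolding F by blast
  have "c \<le> (B1 (x1, t1) - A1 (x1, t1)) * (B2 (x2, t2) - A2 (x2, t2))"
    by (rule envelope_pieces_le_product[OF _ _ _ _ _ _ _ _ pos c])
      (use kinked_bounds[OF Q1 z(2)] kinked_bounds[OF Q2 z(3)] in simp_all)
  then show "F j z \<le> f z"
    using Fj f[of x1 x2 t1 t2] z(1) by simp
next
  fix h z assume h: "convex_on S h" and le: "\<forall>z\<in>S. h z \<le> f z" and "z \<in> S"
  then obtain x1 x2 t1 t2 where z: "z = (x1, x2, t1, t2)" "(x1, t1) \<in> Q1" "(x2, t2) \<in> Q2"
    by (auto simp: S)
  have "h (x1, x2, t1, t2) \<le> (B1 (x1, t1) - A1 (x1, t1)) * (B2 (x2, t2) - A2 (x2, t2))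
      + (k \<bullet> (x1, x2, t1, t2) + c0)" if "(x1, t1) \<in> Q1" "(x2, t2) \<in> Q2" for x1 x2 t1 t2
    using le that unfolding S f[symmetric] by blast
  then obtain c
    where c: "c \<in> envelope_pieces a1 d1 a2 d2 (A1 (x1, t1)) (B1 (x1, t1)) (A2 (x2, t2)) (B2 (x2, t2))"
      and hc: "h z \<le> c + (k \<bullet> (x1, x2, t1, t2) + c0)"
    using convex_minorant_le_shifted_piece[OF Q1 Q2 h[unfolded S] conv _ z(2,3)] unfolding z(1)
    by blast
  from c have "c + (k \<bullet> (x1, x2, t1, t2) + c0) \<in> (\<lambda>j. F j (x1, x2, t1, t2)) ` I"
    unfolding F by (rule imageI)
  then show "\<exists>j\<in>I. h z \<le> F j z"
    using hc z(1) by auto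
qed

section \<open>The pentagon\<close>

text \<open>
  The signed horizontal distance to the line through \<open>v\<^sub>i\<^sub>2\<close> and \<open>v\<^sub>i\<^sub>3\<close>, positive to the left
  of it and scaled by \<open>w\<^sub>i\<close>.
\<close>

definition upper_slack ::
    "(nat \<Rightarrow> nat \<Rightarrow> real) \<Rightarrow> (nat \<Rightarrow> real) \<Rightarrow> (nat \<Rightarrow> real) \<Rightarrow> (nat \<Rightarrow> real) \<Rightarrow>
     nat \<Rightarrow> real \<times> real \<Rightarrow> real" where
  "upper_slack p fL b fU i =
     (\<lambda>(x, t). pent_w p fL b fU i * (p i 2 + pent_r2 p fL b fU i * (t - b i) - x))"

text \<open>
  The signed horizontal distance to the line through \<open>v\<^sub>i\<^sub>1\<close> and \<open>v\<^sub>i\<^sub>2\<close>, positive to the left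
  of it and scaled by \<open>w\<^sub>i\<close>.
  With this scaling the difference of the two slacks is \<open>t - b\<^sub>i\<close>.
\<close>

definition lower_slack ::
    "(nat \<Rightarrow> nat \<Rightarrow> real) \<Rightarrow> (nat \<Rightarrow> real) \<Rightarrow> (nat \<Rightarrow> real) \<Rightarrow> (nat \<Rightarrow> real) \<Rightarrow>
     nat \<Rightarrow> real \<times> real \<Rightarrow> real" where
  "lower_slack p fL b fU i =
     (\<lambda>(x, t). pent_w p fL b fU i * (p i 1 + pent_r1 p fL b fU i * (t - fL i) - x))"

lemma pent_r_mult:
  assumes "fL i < b i" "b i < fU i"
  shows "pent_r1 p fL b fU i * (b i - fL i) = p i 2 - p i 1"
    and "pent_r2 p fL b fU i * (fU i - b i) = 1 - p i 2"
  using assms by (simp_all add: pent_r1_def pent_r2_def)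

lemma pent_w_mult:
  assumes "pent_r2 p fL b fU i < pent_r1 p fL b fU i"
  shows "pent_w p fL b fU i * (pent_r1 p fL b fU i - pent_r2 p fL b fU i) = 1"
  using assms by (simp add: pent_w_def)

lemma convex_pentagon: "convex (pentagon p fL b fU i)"
  by (simp add: pentagon_def)

lemma convex_pentagon_product: "convex (pentagon_product p fL b fU)"
proof (rule convexI)
  fix z z' and u v :: real
  assume "z \<in> pentagon_product p fL b fU" "z' \<in> pentagon_product p fL b fU"
    and uv: "0 \<le> u" "0 \<le> v" "u + v = 1"
  then obtain x1 x2 t1 t2 y1 y2 s1 s2 where
    z: "z = (x1, x2, t1, t2)" "(x1, t1) \<in> pentagon p fL b fU 1" "(x2, t2) \<in> pentagon p fL b fU 2"
    and z': "z' = (y1, y2, s1, s2)" "(y1, s1) \<in> pentagon p fL b fU 1" "(y2, s2) \<in> pentagon p fL b fU 2"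
    by (auto simp: pentagon_product_def)
  have "u *\<^sub>R (x1, t1) + v *\<^sub>R (y1, s1) \<in> pentagon p fL b fU 1"
    "u *\<^sub>R (x2, t2) + v *\<^sub>R (y2, s2) \<in> pentagon p fL b fU 2"
    by (intro convexD[OF convex_pentagon] z z' uv)+
  then show "u *\<^sub>R z + v *\<^sub>R z' \<in> pentagon_product p fL b fU"
    by (simp add: z(1) z'(1) pentagon_product_def)
qed

lemma pent_vertex_image:
  "pent_vertex p fL b fU i ` {0..4} =
     {(0, fL i), (p i 1, fL i), (p i 2, b i), (1, fU i), (0, fU i)}"
proof -
  have "{0..4} = {0, 1, 2, 3, 4::nat}" by auto
  then show ?thesis by (simp add: pent_vertex_def eval_nat_numeral)
qed

lemma pent_vertex_in_pentagon:
  "(0, fL i) \<in> pentagon p fL b fU i" "(p i 1, fL i) \<in> pentagon p fL b fU i"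
  "(p i 2, b i) \<in> pentagon p fL b fU i" "(1, fU i) \<in> pentagon p fL b fU i"
  "(0, fU i) \<in> pentagon p fL b fU i"
  unfolding pentagon_def pent_vertex_image by (simp_all add: hull_inc)

text \<open>
  Points on or to the left of the diagonal from \<open>v\<^sub>i\<^sub>1\<close> to \<open>v\<^sub>i\<^sub>3\<close> are combinations of a point on
  the bottom edge and a point on the top edge.
\<close>

lemma trapezoid_decomposition:
  assumes p1: "0 \<le> p i 1" "p i 1 \<le> 1" and lu: "0 \<le> l" "0 \<le> u" "l + u = 1"
    and x: "0 \<le> x" "x \<le> l * p i 1 + u"
  shows "\<exists>y\<in>pentagon p fL b fU i. \<exists>v\<in>pentagon p fL b fU i.
    snd y = fL i \<and> snd v = fU i \<and> (x, l * fL i + u * fU i) = l *\<^sub>R y + u *\<^sub>R v"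
proof -
  \<comment> \<open>the fraction of the width of the trapezoid at height \<open>l * fL i + u * fU i\<close>; if that width
    vanishes then \<open>x = 0\<close>, and \<open>s = 0\<close> by division by zero is correct\<close>
  define s where "s = x / (l * p i 1 + u)"
  have s: "0 \<le> s" "s \<le> 1" "s * (l * p i 1 + u) = x"
    using x by (auto simp: s_def divide_le_eq_1)
  have "(1 - s) *\<^sub>R (0, fL i) + s *\<^sub>R (p i 1, fL i) \<in> pentagon p fL b fU i"
    and "(1 - s) *\<^sub>R (0, fU i) + s *\<^sub>R (1, fU i) \<in> pentagon p fL b fU i"
    using s by (intro convexD convex_pentagon pent_vertex_in_pentagon; simp)+
  then have "(s * p i 1, fL i) \<in> pentagon p fL b fU i" "(s, fU i) \<in> pentagon p fL b fU i"
    by (simp_all add: algebra_simps)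
  moreover have "(x, l * fL i + u * fU i) = l *\<^sub>R (s * p i 1, fL i) + u *\<^sub>R (s, fU i)"
    using s(3) by (simp add: algebra_simps)
  ultimately show ?thesis
    by (metis snd_conv)
qed

context
  fixes p :: "nat \<Rightarrow> nat \<Rightarrow> real" and fL b fU :: "nat \<Rightarrow> real" and i :: nat
  assumes p_bounds: "0 \<le> p i 1" "p i 1 < p i 2" "p i 2 \<le> 1"
    and f_bounds: "fL i < b i" "b i < fU i"
begin

text \<open>
  If the slopes were not in this order, \<open>v\<^sub>i\<^sub>2\<close> would lie in the trapezoid
  \<open>v\<^sub>i\<^sub>0 v\<^sub>i\<^sub>1 v\<^sub>i\<^sub>3 v\<^sub>i\<^sub>4\<close>, strictly between its top and its bottom.
\<close>

lemma pent_r2_less_r1: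
  assumes "(p i 2, b i) extreme_point_of pentagon p fL b fU i"
  shows "pent_r2 p fL b fU i < pent_r1 p fL b fU i"
proof (rule ccontr)
  assume "\<not> ?thesis"
  then have r: "pent_r1 p fL b fU i \<le> pent_r2 p fL b fU i" by simp
  define a d where "a = b i - fL i" and "d = fU i - b i"
  have ad: "0 < a" "0 < d" using f_bounds by (simp_all add: a_def d_def)
  define l u where "l = d / (a + d)" and "u = a / (a + d)"
  have lu: "0 < l" "0 < u" "l + u = 1"
    using ad by (simp_all add: l_def u_def flip: add_divide_distrib)
  have lu_a: "l * a = u * d" by (simp add: l_def u_def)
  have p2: "p i 1 = p i 2 - pent_r1 p fL b fU i * a" "1 = p i 2 + pent_r2 p fL b fU i * d"
    using pent_r_mult[of fL i b fU p, OF f_bounds] by (simp_all add: a_def d_def)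
  have "pent_r1 p fL b fU i * (l * a) \<le> pent_r2 p fL b fU i * (u * d)"
    using r lu_a lu ad by (simp add: mult_right_mono)
  moreover have "l * p i 1 + u = l * (p i 2 - pent_r1 p fL b fU i * a) + u * (p i 2 + pent_r2 p fL b fU i * d)"
    using p2 by simp
  moreover have "\<dots> = (l + u) * p i 2 + (pent_r2 p fL b fU i * (u * d) - pent_r1 p fL b fU i * (l * a))"
    by (simp add: algebra_simps)
  ultimately have "p i 2 \<le> l * p i 1 + u"
    using lu(3) by simp
  then have "\<exists>y\<in>pentagon p fL b fU i. \<exists>v\<in>pentagon p fL b fU i.
      snd y = fL i \<and> snd v = fU i \<and> (p i 2, l * fL i + u * fU i) = l *\<^sub>R y + u *\<^sub>R v"
    using p_bounds lu by (intro trapezoid_decomposition) auto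
  then obtain y v where yv: "y \<in> pentagon p fL b fU i" "v \<in> pentagon p fL b fU i"
    and snd_yv: "snd y = fL i" "snd v = fU i" and p2_eq: "(p i 2, l * fL i + u * fU i) = l *\<^sub>R y + u *\<^sub>R v"
    by blast
  have "l * fL i + u * fU i = (l + u) * b i + (u * d - l * a)"
    by (simp add: a_def d_def algebra_simps)
  then have "b i = l * fL i + u * fU i"
    using lu(3) lu_a by simp
  moreover have "l = 1 - u" using lu(3) by simp
  ultimately have "(p i 2, b i) = (1 - u) *\<^sub>R y + u *\<^sub>R v"
    using p2_eq by simp
  moreover have "y \<noteq> v" using snd_yv f_bounds by auto
  moreover have "u < 1" using lu by linarith
  ultimately have "(p i 2, b i) \<in> open_segment y v"
    using lu by (auto simp: in_segment)
  then show False
    using assms yv unfolding extreme_point_of_def by blast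
qed

context
  assumes r_less: "pent_r2 p fL b fU i < pent_r1 p fL b fU i"
begin

lemma lower_minus_upper_slack:
  "lower_slack p fL b fU i z - upper_slack p fL b fU i z = snd z - b i"
proof -
  let ?w = "pent_w p fL b fU i" and ?r1 = "pent_r1 p fL b fU i" and ?r2 = "pent_r2 p fL b fU i"
  have "lower_slack p fL b fU i z - upper_slack p fL b fU i z
      = ?w * (?r1 - ?r2) * (snd z - b i) + ?w * (?r1 * (b i - fL i) - (p i 2 - p i 1))"
    by (simp add: lower_slack_def upper_slack_def case_prod_beta algebra_simps)
  then show ?thesis
    using pent_w_mult[OF r_less] pent_r_mult[of fL i b fU p, OF f_bounds] by simp
qed

lemma fst_eq_slacks:
  "fst z = p i 2 - pent_r1 p fL b fU i * upper_slack p fL b fU i z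
     + pent_r2 p fL b fU i * lower_slack p fL b fU i z"
proof -
  let ?w = "pent_w p fL b fU i" and ?r1 = "pent_r1 p fL b fU i" and ?r2 = "pent_r2 p fL b fU i"
  have lower: "lower_slack p fL b fU i z = upper_slack p fL b fU i z + (snd z - b i)"
    using lower_minus_upper_slack[of z] by simp
  have "?r1 * upper_slack p fL b fU i z - ?r2 * lower_slack p fL b fU i z
      = (?r1 - ?r2) * upper_slack p fL b fU i z - ?r2 * (snd z - b i)"
    unfolding lower by (simp add: algebra_simps)
  also have "(?r1 - ?r2) * upper_slack p fL b fU i z
      = (?w * (?r1 - ?r2)) * (p i 2 + ?r2 * (snd z - b i) - fst z)"
    by (simp add: upper_slack_def case_prod_beta)
  finally show ?thesis
    using pent_w_mult[OF r_less] by simp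
qed

lemma pentagon_bounds:
  assumes "z \<in> pentagon p fL b fU i"
  shows "0 \<le> fst z" "fL i \<le> snd z" "snd z \<le> fU i"
    "0 \<le> upper_slack p fL b fU i z" "0 \<le> lower_slack p fL b fU i z"
proof -
  let ?r1 = "pent_r1 p fL b fU i" and ?r2 = "pent_r2 p fL b fU i"
  \<comment> \<open>five half-planes that contain all vertices, hence the pentagon\<close>
  define H where "H = {z :: real \<times> real. (- 1, 0) \<bullet> z \<le> 0} \<inter> {z. (0, - 1) \<bullet> z \<le> - fL i}
    \<inter> {z. (0, 1) \<bullet> z \<le> fU i} \<inter> {z. (1, - ?r1) \<bullet> z \<le> p i 1 - ?r1 * fL i}
    \<inter> {z. (1, - ?r2) \<bullet> z \<le> p i 2 - ?r2 * b i}"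
  have "convex H"
    unfolding H_def by (intro convex_Int convex_halfspace_le)
  moreover have "pent_vertex p fL b fU i ` {0..4} \<subseteq> H"
  proof -
    have "?r2 * (b i - fL i) \<le> ?r1 * (b i - fL i)" "?r2 * (fU i - b i) \<le> ?r1 * (fU i - b i)"
      using r_less f_bounds by (simp_all add: mult_right_mono)
    then show ?thesis
      using pent_r_mult[of fL i b fU p, OF f_bounds] p_bounds f_bounds
      unfolding pent_vertex_image H_def by (simp add: algebra_simps)
  qed
  ultimately have "z \<in> H"
    using assms hull_minimal unfolding pentagon_def by blast
  then have z: "0 \<le> fst z" "fL i \<le> snd z" "snd z \<le> fU i"
      "0 \<le> p i 2 + ?r2 * (snd z - b i) - fst z" "0 \<le> p i 1 + ?r1 * (snd z - fL i) - fst z"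
    by (simp_all add: H_def inner_prod_def algebra_simps)
  show "0 \<le> fst z" "fL i \<le> snd z" "snd z \<le> fU i" by fact+
  have "0 < pent_w p fL b fU i" using r_less by (simp add: pent_w_def)
  then show "0 \<le> upper_slack p fL b fU i z" "0 \<le> lower_slack p fL b fU i z"
    using z(4,5) by (simp_all add: upper_slack_def lower_slack_def case_prod_beta)
qed

lemma kinked_pentagon:
  "kinked (pentagon p fL b fU i) (upper_slack p fL b fU i) (lower_slack p fL b fU i)
     (b i - fL i) (fU i - b i)"
  unfolding kinked_def lower_minus_upper_slack
proof (intro conjI ballI)
  fix z assume z: "z \<in> pentagon p fL b fU i"
  show "0 \<le> upper_slack p fL b fU i z" "0 \<le> lower_slack p fL b fU i z"
    "- (b i - fL i) \<le> snd z - b i" "snd z - b i \<le> fU i - b i"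
    using pentagon_bounds[OF z] by simp_all
  define A B where "A = upper_slack p fL b fU i z" and "B = lower_slack p fL b fU i z"
  let ?r1 = "pent_r1 p fL b fU i" and ?r2 = "pent_r2 p fL b fU i"
  define a d where "a = b i - fL i" and "d = fU i - b i"
  have ad: "0 < a" "0 < d" using f_bounds by (simp_all add: a_def d_def)
  have fLU: "fL i = b i - a" "fU i = b i + d" by (simp_all add: a_def d_def)
  have p12: "p i 1 = p i 2 - ?r1 * a" "1 = p i 2 + ?r2 * d"
    using pent_r_mult[of fL i b fU p, OF f_bounds] by (simp_all add: a_def d_def)
  have AB: "0 \<le> A" "0 \<le> B" using pentagon_bounds[OF z] by (simp_all add: A_def B_def)
  have t: "snd z - b i = B - A" by (simp add: A_def B_def lower_minus_upper_slack)
  have x: "fst z = p i 2 - ?r1 * A + ?r2 * B" unfolding A_def B_def by (rule fst_eq_slacks)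
  have "\<exists>l m u. 0 \<le> l \<and> 0 \<le> m \<and> 0 \<le> u \<and> l + m + u = 1 \<and>
        d * u - a * l = snd z - b i \<and> (m \<noteq> 0 \<longrightarrow> a * l = A \<and> d * u = B) \<and>
        (\<exists>x\<in>pentagon p fL b fU i. \<exists>y\<in>pentagon p fL b fU i. \<exists>v\<in>pentagon p fL b fU i.
           snd x - b i = - a \<and> snd y - b i = 0 \<and> snd v - b i = d \<and>
           z = l *\<^sub>R x + m *\<^sub>R y + u *\<^sub>R v)"
  \<comment> \<open>the sum is at most 1 exactly if \<open>z\<close> is on or to the right of the diagonal from \<open>v\<^sub>i\<^sub>1\<close> to \<open>v\<^sub>i\<^sub>3\<close>\<close>
  proof (cases "A / a + B / d \<le> 1")
    case True
    define l u where "l = A / a" and "u = B / d"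
    have lu: "a * l = A" "d * u = B" using ad by (simp_all add: l_def u_def)
    have "fst z = l * p i 1 + (1 - l - u) * p i 2 + u"
    proof -
      have "l * p i 1 + (1 - l - u) * p i 2 + u * 1
          = l * (p i 2 - ?r1 * a) + (1 - l - u) * p i 2 + u * (p i 2 + ?r2 * d)"
        using p12 by simp
      also have "\<dots> = p i 2 - ?r1 * (a * l) + ?r2 * (d * u)"
        by (simp add: algebra_simps)
      finally show ?thesis using x lu by simp
    qed
    moreover have "snd z = l * fL i + (1 - l - u) * b i + u * fU i"
      using t lu by (simp add: fLU algebra_simps)
    ultimately have "z = l *\<^sub>R (p i 1, fL i) + (1 - l - u) *\<^sub>R (p i 2, b i) + u *\<^sub>R (1, fU i)"
      by (intro prod_eqI) simp_all
    then have "\<exists>x\<in>pentagon p fL b fU i. \<exists>y\<in>pentagon p fL b fU i. \<exists>v\<in>pentagon p fL b fU i.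
           snd x - b i = - a \<and> snd y - b i = 0 \<and> snd v - b i = d \<and>
           z = l *\<^sub>R x + (1 - l - u) *\<^sub>R y + u *\<^sub>R v"
      by - (rule bexI[OF _ pent_vertex_in_pentagon(2)], rule bexI[OF _ pent_vertex_in_pentagon(3)],
          rule bexI[OF _ pent_vertex_in_pentagon(4)], simp add: fLU)
    moreover have "0 \<le> l" "0 \<le> u" "l + u \<le> 1"
      using True AB ad by (simp_all add: l_def u_def)
    ultimately show ?thesis
      using lu t by (intro exI[of _ l] exI[of _ "1 - l - u"] exI[of _ u]) simp
  next
    case False
    \<comment> \<open>with \<open>m = 0\<close> the weights are determined by the height\<close>
    define l u where "l = (d - (B - A)) / (a + d)" and "u = (a + (B - A)) / (a + d)"
    have "0 \<le> l" "0 \<le> u"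
      using pentagon_bounds(2,3)[OF z] ad t by (simp_all add: l_def u_def fLU)
    moreover have lu: "l + u = 1"
      using ad by (simp add: l_def u_def flip: add_divide_distrib)
    moreover have du: "d * u - a * l = B - A"
    proof -
      have "l * (a + d) = d - (B - A)" "u * (a + d) = a + (B - A)"
        using ad by (simp_all add: l_def u_def)
      moreover have "(d * u - a * l) * (a + d) = d * (u * (a + d)) - a * (l * (a + d))"
        by (simp add: algebra_simps)
      ultimately have "(d * u - a * l) * (a + d) = d * (a + (B - A)) - a * (d - (B - A))"
        by simp
      also have "\<dots> = (B - A) * (a + d)"
        by (simp add: algebra_simps)
      finally have "(d * u - a * l) * (a + d) = (B - A) * (a + d)" .
      then show ?thesis using ad by simp
    qed
    moreover have "fst z \<le> l * p i 1 + u"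
    proof -
      have "a * d \<le> A * d + B * a"
        using False ad by (simp add: field_simps)
      then have "0 \<le> (A * d + B * a - a * d) / (a + d)"
        using ad by simp
      also have "\<dots> = A - a * l"
        using ad by (simp add: l_def field_simps)
      finally have "0 \<le> (?r1 - ?r2) * (A - a * l)"
        using r_less by simp
      moreover have "B - d * u = A - a * l" using du by simp
      ultimately have "0 \<le> ?r1 * (A - a * l) - ?r2 * (B - d * u)"
        by (simp add: left_diff_distrib)
      moreover have "l * p i 1 + u * 1 = l * (p i 2 - ?r1 * a) + u * (p i 2 + ?r2 * d)"
        using p12 by simp
      moreover have "\<dots> = (l + u) * p i 2 - ?r1 * (a * l) + ?r2 * (d * u)"
        by (simp add: algebra_simps)
      ultimately show ?thesis
        using lu x by (simp add: algebra_simps)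
    qed
    ultimately have "\<exists>y\<in>pentagon p fL b fU i. \<exists>v\<in>pentagon p fL b fU i.
        snd y = fL i \<and> snd v = fU i \<and> (fst z, l * fL i + u * fU i) = l *\<^sub>R y + u *\<^sub>R v"
      using p_bounds pentagon_bounds(1)[OF z] by (intro trapezoid_decomposition) auto
    then obtain y v where yv: "y \<in> pentagon p fL b fU i" "v \<in> pentagon p fL b fU i"
      "snd y = fL i" "snd v = fU i" "(fst z, l * fL i + u * fU i) = l *\<^sub>R y + u *\<^sub>R v"
      by blast
    have "l * fL i + u * fU i = (l + u) * b i + (d * u - a * l)"
      by (simp add: fLU algebra_simps)
    then have "snd z = l * fL i + u * fU i" using lu du t by simp
    then have "z = l *\<^sub>R y + u *\<^sub>R v" by (metis yv(5) prod.collapse)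
    then have "\<exists>x\<in>pentagon p fL b fU i. \<exists>y\<in>pentagon p fL b fU i. \<exists>v\<in>pentagon p fL b fU i.
           snd x - b i = - a \<and> snd y - b i = 0 \<and> snd v - b i = d \<and>
           z = l *\<^sub>R x + 0 *\<^sub>R y + u *\<^sub>R v"
      by - (rule bexI[OF _ yv(1)], rule bexI[OF _ pent_vertex_in_pentagon(3)],
          rule bexI[OF _ yv(2)], simp add: yv(3,4) fLU zero_prod_def)
    then show ?thesis
      using \<open>0 \<le> l\<close> \<open>0 \<le> u\<close> lu du t
      by (intro exI[of _ l] exI[of _ "0::real"] exI[of _ u]) simp
  qed
  then show "\<exists>l m u. 0 \<le> l \<and> 0 \<le> m \<and> 0 \<le> u \<and> l + m + u = 1 \<and>
        (fU i - b i) * u - (b i - fL i) * l = snd z - b i \<and>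
        (m \<noteq> 0 \<longrightarrow> (b i - fL i) * l = upper_slack p fL b fU i z \<and>
           (fU i - b i) * u = lower_slack p fL b fU i z) \<and>
        (\<exists>x\<in>pentagon p fL b fU i. \<exists>y\<in>pentagon p fL b fU i. \<exists>v\<in>pentagon p fL b fU i.
           snd x - b i = - (b i - fL i) \<and> snd y - b i = 0 \<and> snd v - b i = fU i - b i \<and>
           z = l *\<^sub>R x + m *\<^sub>R y + u *\<^sub>R v)"
    unfolding A_def B_def a_def d_def .
qed

end

end

section \<open>The twelve affine functions in slack coordinates\<close>

context
  fixes p :: "nat \<Rightarrow> nat \<Rightarrow> real" and fL b fU :: "nat \<Rightarrow> real"
  assumes f_bounds: "fL 1 < b 1" "b 1 < fU 1" "fL 2 < b 2" "b 2 < fU 2"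
    and r_less: "pent_r2 p fL b fU 1 < pent_r1 p fL b fU 1"
      "pent_r2 p fL b fU 2 < pent_r1 p fL b fU 2"
begin

lemma atLeastAtMost_1_6: "{1..6} = {1, 2, 3, 4, 5, 6::nat}"
  by auto

lemmas slope_relations =
  pent_w_mult[OF r_less(1)] pent_w_mult[OF r_less(2)]
  pent_r_mult[of fL 1 b fU p, OF f_bounds(1,2)] pent_r_mult[of fL 2 b fU p, OF f_bounds(3,4)]

text \<open>
  The affine shift is \<open>t\<^sub>1 t\<^sub>2 - (t\<^sub>1 - b\<^sub>1) (t\<^sub>2 - b\<^sub>2) = b\<^sub>2 t\<^sub>1 + b\<^sub>1 t\<^sub>2 - b\<^sub>1 b\<^sub>2\<close>, and its negative for
  the concave envelope.
\<close>

lemma alpha_rows_eq_pieces: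
  "(\<lambda>j. alpha_row p fL b fU j \<bullet> (x1, x2, t1, t2) + alpha_const p fL b fU j) ` {1..6} =
   (\<lambda>c. c + ((0, 0, b 2, b 1) \<bullet> (x1, x2, t1, t2) + - (b 1 * b 2))) `
     envelope_pieces (b 1 - fL 1) (fU 1 - b 1) (b 2 - fL 2) (fU 2 - b 2)
       (upper_slack p fL b fU 1 (x1, t1)) (lower_slack p fL b fU 1 (x1, t1))
       (upper_slack p fL b fU 2 (x2, t2)) (lower_slack p fL b fU 2 (x2, t2))"
  unfolding atLeastAtMost_1_6 envelope_pieces_def image_insert image_empty
  by (intro arg_cong2[where f = insert] refl;
      insert slope_relations, simp add: alpha_row_def alpha_const_def upper_slack_def lower_slack_def Let_def;
      algebra)

lemma beta_rows_eq_pieces: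
  "(\<lambda>k. - (beta_row p fL b fU k \<bullet> (x1, x2, t1, t2) + beta_const p fL b fU k)) ` {1..6} =
   (\<lambda>c. c + ((0, 0, - b 2, - b 1) \<bullet> (x1, x2, t1, t2) + b 1 * b 2)) `
     envelope_pieces (b 1 - fL 1) (fU 1 - b 1) (fU 2 - b 2) (b 2 - fL 2)
       (upper_slack p fL b fU 1 (x1, t1)) (lower_slack p fL b fU 1 (x1, t1))
       (lower_slack p fL b fU 2 (x2, t2)) (upper_slack p fL b fU 2 (x2, t2))"
proof -
  \<comment> \<open>the exchange turns the first piece into the second row and vice versa\<close>
  have swap: "{1, 2, 3, 4, 5, 6::nat} = {2, 1, 3, 4, 5, 6}"
    by auto
  show ?thesis
    unfolding atLeastAtMost_1_6 swap envelope_pieces_def image_insert image_empty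
    by (intro arg_cong2[where f = insert] refl;
        insert slope_relations, simp add: beta_row_def beta_const_def upper_slack_def lower_slack_def Let_def;
        algebra)
qed

end

section \<open>The envelopes of the product\<close>

theorem theorem1:
  fixes p :: "nat \<Rightarrow> nat \<Rightarrow> real" and fL b fU :: "nat \<Rightarrow> real"
  assumes p_bounds: "\<And>i. i \<in> {1, 2} \<Longrightarrow> 0 \<le> p i 1 \<and> p i 1 < p i 2 \<and> p i 2 \<le> 1"
    and f_bounds: "\<And>i. i \<in> {1, 2} \<Longrightarrow> fL i < b i \<and> b i < fU i"
    and vertices: "\<And>i. i \<in> {1, 2} \<Longrightarrow>
      {v. v extreme_point_of pentagon p fL b fU i} = pent_vertex p fL b fU i ` {0..4}"
  shows "is_convex_envelope (pentagon_product p fL b fU)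
           (\<lambda>(x1, x2, t1, t2). t1 * t2)
           (\<lambda>z. MAX j\<in>{1..6}. alpha_row p fL b fU j \<bullet> z + alpha_const p fL b fU j) \<and>
         is_concave_envelope (pentagon_product p fL b fU)
           (\<lambda>(x1, x2, t1, t2). t1 * t2)
           (\<lambda>z. MIN k\<in>{1..6}. beta_row p fL b fU k \<bullet> z + beta_const p fL b fU k)"
proof -
  let ?S = "pentagon_product p fL b fU" and ?P = "pentagon p fL b fU"
  let ?A = "upper_slack p fL b fU" and ?B = "lower_slack p fL b fU"
  have r_less: "pent_r2 p fL b fU i < pent_r1 p fL b fU i" if "i \<in> {1, 2}" for i
  proof -
    have "(p i 2, b i) extreme_point_of ?P i"
      using vertices[OF that] unfolding pent_vertex_image by blast
    then show ?thesis
      using p_bounds[OF that] f_bounds[OF that] by (intro pent_r2_less_r1) auto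
  qed
  have diff: "?B i z - ?A i z = snd z - b i" if "i \<in> {1, 2}" for i z
    using p_bounds[OF that] f_bounds[OF that] r_less[OF that]
    by (intro lower_minus_upper_slack) auto
  have kinked: "kinked (?P i) (?A i) (?B i) (b i - fL i) (fU i - b i)" if "i \<in> {1, 2}" for i
    using p_bounds[OF that] f_bounds[OF that] r_less[OF that] by (intro kinked_pentagon) auto
  have 12: "1 \<in> {1, 2::nat}" "2 \<in> {1, 2::nat}" by simp_all
  have fb: "fL 1 < b 1" "b 1 < fU 1" "fL 2 < b 2" "b 2 < fU 2"
    using f_bounds 12 by blast+
  have alpha: "is_convex_envelope ?S (\<lambda>(x1, x2, t1, t2). t1 * t2)
      (\<lambda>z. MAX j\<in>{1..6}. alpha_row p fL b fU j \<bullet> z + alpha_const p fL b fU j)"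
  proof (rule is_convex_envelope_kinked_product[OF kinked[OF 12(1)] kinked[OF 12(2)]
        convex_pentagon convex_pentagon])
    show "convex_on ?S (\<lambda>z. alpha_row p fL b fU j \<bullet> z + alpha_const p fL b fU j)" for j
      by (intro convex_on_affine convex_pentagon_product)
    show "(\<lambda>j. alpha_row p fL b fU j \<bullet> (x1, x2, t1, t2) + alpha_const p fL b fU j) ` {1..6} =
      (\<lambda>c. c + ((0, 0, b 2, b 1) \<bullet> (x1, x2, t1, t2) + - (b 1 * b 2))) `
        envelope_pieces (b 1 - fL 1) (fU 1 - b 1) (b 2 - fL 2) (fU 2 - b 2)
          (?A 1 (x1, t1)) (?B 1 (x1, t1)) (?A 2 (x2, t2)) (?B 2 (x2, t2))" for x1 x2 t1 t2
      by (rule alpha_rows_eq_pieces[OF fb r_less[OF 12(1)] r_less[OF 12(2)]])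
    show "(case (x1, x2, t1, t2) of (x1, x2, t1, t2) \<Rightarrow> t1 * t2) =
        (?B 1 (x1, t1) - ?A 1 (x1, t1)) * (?B 2 (x2, t2) - ?A 2 (x2, t2)) +
        ((0, 0, b 2, b 1) \<bullet> (x1, x2, t1, t2) + - (b 1 * b 2))" for x1 x2 t1 t2 :: real
      unfolding diff[OF 12(1)] diff[OF 12(2)] by (simp add: algebra_simps)
  qed (use fb in \<open>simp_all add: pentagon_product_def\<close>)
  \<comment> \<open>the second factor changes sign, so its two slacks change places\<close>
  have beta: "is_convex_envelope ?S (\<lambda>z. - (case z of (x1, x2, t1, t2) \<Rightarrow> t1 * t2))
      (\<lambda>z. MAX k\<in>{1..6}. - (beta_row p fL b fU k \<bullet> z + beta_const p fL b fU k))"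
  proof (rule is_convex_envelope_kinked_product[OF kinked[OF 12(1)]
        kinked_swap[OF kinked[OF 12(2)]] convex_pentagon convex_pentagon])
    have "convex_on ?S (\<lambda>z. - beta_row p fL b fU k \<bullet> z + - beta_const p fL b fU k)" for k
      by (intro convex_on_affine convex_pentagon_product)
    then show "convex_on ?S (\<lambda>z. - (beta_row p fL b fU k \<bullet> z + beta_const p fL b fU k))" for k
      by simp
    show "(\<lambda>k. - (beta_row p fL b fU k \<bullet> (x1, x2, t1, t2) + beta_const p fL b fU k)) ` {1..6} =
      (\<lambda>c. c + ((0, 0, - b 2, - b 1) \<bullet> (x1, x2, t1, t2) + b 1 * b 2)) `
        envelope_pieces (b 1 - fL 1) (fU 1 - b 1) (fU 2 - b 2) (b 2 - fL 2)
          (?A 1 (x1, t1)) (?B 1 (x1, t1)) (?B 2 (x2, t2)) (?A 2 (x2, t2))" for x1 x2 t1 t2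
      by (rule beta_rows_eq_pieces[OF fb r_less[OF 12(1)] r_less[OF 12(2)]])
    show "- (case (x1, x2, t1, t2) of (x1, x2, t1, t2) \<Rightarrow> t1 * t2) =
        (?B 1 (x1, t1) - ?A 1 (x1, t1)) * (?A 2 (x2, t2) - ?B 2 (x2, t2)) +
        ((0, 0, - b 2, - b 1) \<bullet> (x1, x2, t1, t2) + b 1 * b 2)" for x1 x2 t1 t2 :: real
    proof -
      have flip: "?A 2 (x2, t2) - ?B 2 (x2, t2) = - (t2 - b 2)"
        using diff[OF 12(2), of "(x2, t2)"] by simp
      show ?thesis
        unfolding diff[OF 12(1)] flip by (simp add: algebra_simps)
    qed
  qed (use fb in \<open>simp_all add: pentagon_product_def\<close>)
  show ?thesis
    using alpha is_concave_envelope_MIN[OF _ _ beta] by simp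
qed

end
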